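(* Let $H$ be a complex Hilbert space, let $B$ be a bounded self-adjoint operator on $H$ (everywhere defined), and let $A$ be an unbounded self-adjoint operator in $H$ which is positive. Assume that $BA$ is normal. Then both $BA$ and $AB$ are self-adjoint. Moreover, $AB=BA$ (as unbounded operators, including equality of domains).
   Context: Products carry their natural domains: $D(BA)=D(A)$ and $D(AB)=\{x\in H: Bx\in D(A)\}$. A densely defined operator $T$ is normal if it is closed and $TT^*=T^*T$ (including equality of domains), and self-adjoint if $T=T^*$. Positive means nonnegative: $\langle Ax,x\rangle\ge 0$ for all $x\in D(A)$. *)

theory Defs
  imports "HOL-Analysis.Analysis"
begin

section \<open>Complex Hilbert spaces\<close>

text \<open>
  The distribution has real inner product spaces only. A complex inner product space is
  presented as a real one carrying in addition a complex scalar multiplication that extends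
  the real one, and a sesquilinear, Hermitian form (linear in the first argument) whose real
  part is the given real inner product. Positive definiteness and
  \<open>norm x = sqrt (Re (cinner x x))\<close> are inherited from the axioms of \<^class>\<open>real_inner\<close>.
\<close>

class complex_inner = real_inner +
  fixes scaleC :: "complex \<Rightarrow> 'a \<Rightarrow> 'a" (infixr "*\<^sub>C" 75)
    and cinner :: "'a \<Rightarrow> 'a \<Rightarrow> complex"
  assumes scaleC_add_right: "c *\<^sub>C (x + y) = c *\<^sub>C x + c *\<^sub>C y"
    and scaleC_add_left: "(c + d) *\<^sub>C x = c *\<^sub>C x + d *\<^sub>C x"
    and scaleC_scaleC: "c *\<^sub>C d *\<^sub>C x = (c * d) *\<^sub>C x"
    and scaleC_of_real: "complex_of_real r *\<^sub>C x = r *\<^sub>R x"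
    and cinner_commute: "cinner x y = cnj (cinner y x)"
    and cinner_add_left: "cinner (x + y) z = cinner x z + cinner y z"
    and cinner_scaleC_left: "cinner (c *\<^sub>C x) y = c * cinner x y"
    and Re_cinner: "Re (cinner x y) = inner x y"

class chilbert_space = complex_inner + complete_space

instantiation complex :: chilbert_space
begin

definition scaleC_complex :: "complex \<Rightarrow> complex \<Rightarrow> complex"
  where "scaleC_complex c x = c * x"

definition cinner_complex :: "complex \<Rightarrow> complex \<Rightarrow> complex"
  where "cinner_complex x y = x * cnj y"

instance
  by standard
    (auto simp: scaleC_complex_def cinner_complex_def inner_complex_def algebra_simps
      scaleR_conv_of_real)

end

lemma cinner_self: "cinner x x = complex_of_real ((norm x)\<^sup>2)"
  for x :: "'a::complex_inner"
proof -
  have "Im (cinner x x) = 0"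
    using arg_cong [OF cinner_commute [of x x], of Im] by simp
  then show ?thesis
    by (simp add: complex_eq_iff Re_cinner dot_square_norm)
qed

section \<open>Unbounded operators\<close>

text \<open>
  An operator \<open>T\<close> with domain \<open>D(T)\<close> is a partial map \<open>T :: 'a \<rightharpoonup> 'a\<close>
  with \<open>D(T) = dom T\<close>. Hence \<open>=\<close> is equality of operators including equality
  of domains, and \<open>S \<circ>\<^sub>m T\<close> is the product \<open>ST\<close> on its natural domain
  \<open>{x \<in> D(T). T x \<in> D(S)}\<close>. As usual, an unbounded operator is one that need not be
  bounded or everywhere defined.
\<close>

definition linear_op :: "('a::complex_inner \<rightharpoonup> 'a) \<Rightarrow> bool" where
  "linear_op T \<longleftrightarrow>
     T 0 = Some 0 \<and>
     (\<forall>x y u v. T x = Some u \<and> T y = Some v \<longrightarrow> T (x + y) = Some (u + v)) \<and>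
     (\<forall>c x u. T x = Some u \<longrightarrow> T (c *\<^sub>C x) = Some (c *\<^sub>C u))"

definition densely_defined :: "('a::complex_inner \<rightharpoonup> 'a) \<Rightarrow> bool" where
  "densely_defined T \<longleftrightarrow> linear_op T \<and> closure (dom T) = UNIV"

definition closed_op :: "('a::complex_inner \<rightharpoonup> 'a) \<Rightarrow> bool" where
  "closed_op T \<longleftrightarrow> closed (Map.graph T)"

definition bounded_op :: "('a::complex_inner \<rightharpoonup> 'a) \<Rightarrow> bool" where
  "bounded_op T \<longleftrightarrow>
     linear_op T \<and> dom T = UNIV \<and> (\<exists>K. \<forall>x. norm (the (T x)) \<le> K * norm x)"

text \<open>
  The adjoint is meaningful for densely defined \<open>T\<close>, where the vector \<open>z\<close> below is
  unique; see \<open>adj_op_eq_Some_iff\<close>.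
\<close>

definition adj_op :: "('a::complex_inner \<rightharpoonup> 'a) \<Rightarrow> ('a \<rightharpoonup> 'a)" where
  "adj_op T = (\<lambda>y.
     if \<exists>z. \<forall>x\<in>dom T. cinner (the (T x)) y = cinner x z
     then Some (THE z. \<forall>x\<in>dom T. cinner (the (T x)) y = cinner x z)
     else None)"

definition selfadjoint_op :: "('a::complex_inner \<rightharpoonup> 'a) \<Rightarrow> bool" where
  "selfadjoint_op T \<longleftrightarrow> densely_defined T \<and> T = adj_op T"

definition normal_op :: "('a::complex_inner \<rightharpoonup> 'a) \<Rightarrow> bool" where
  "normal_op T \<longleftrightarrow>
     densely_defined T \<and> closed_op T \<and> T \<circ>\<^sub>m adj_op T = adj_op T \<circ>\<^sub>m T"

definition positive_op :: "('a::complex_inner \<rightharpoonup> 'a) \<Rightarrow> bool" where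
  "positive_op T \<longleftrightarrow> (\<forall>x\<in>dom T. cinner (the (T x)) x \<in> \<real>\<^sub>\<ge>\<^sub>0)"

lemma cinner_dense_unique:
  fixes z w :: "'a::complex_inner"
  assumes dense: "closure S = UNIV" and eq: "\<And>x. x \<in> S \<Longrightarrow> cinner x z = cinner x w"
  shows "z = w"
proof -
  have "closed {x. inner x (z - w) = 0}"
    by (intro closed_Collect_eq continuous_intros)
  moreover have "S \<subseteq> {x. inner x (z - w) = 0}"
    using eq by (auto simp: inner_diff_right) (metis Re_cinner)
  ultimately have "closure S \<subseteq> {x. inner x (z - w) = 0}"
    by (rule closure_minimal [rotated])
  then have "inner (z - w) (z - w) = 0"
    using dense by blast
  then show ?thesis by simp
qed

lemma adj_op_eq_Some_iff:
  assumes "densely_defined T"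
  shows "adj_op T y = Some z \<longleftrightarrow> (\<forall>x u. T x = Some u \<longrightarrow> cinner u y = cinner x z)"
proof -
  let ?P = "\<lambda>z. \<forall>x\<in>dom T. cinner (the (T x)) y = cinner x z"
  have uniq: "v = w" if "?P v" "?P w" for v w
    using assms that by (intro cinner_dense_unique [of "dom T"]) (auto simp: densely_defined_def)
  have "adj_op T y = Some z \<longleftrightarrow> ?P z"
  proof
    assume "?P z"
    moreover from this have "(THE z. ?P z) = z"
      using uniq by (intro the_equality) blast+
    ultimately show "adj_op T y = Some z"
      by (auto simp: adj_op_def)
  next
    assume *: "adj_op T y = Some z"
    then obtain w where w: "?P w"
      by (auto simp: adj_op_def split: if_splits)
    then have "(THE z. ?P z) = w"
      using uniq by (intro the_equality) blast+
    moreover have "z = (THE z. ?P z)"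
      using * by (auto simp: adj_op_def split: if_splits)
    ultimately show "?P z"
      using w by simp
  qed
  then show ?thesis
    by (auto simp: dom_def)
qed

end

theory Submission
  imports Defs
begin

text \<open>
  Let \<open>N = BA\<close>; since \<open>B\<close> is bounded and self-adjoint, \<open>N\<^sup>* = AB\<close>. The resolvent
  \<open>T = (1 + N\<^sup>*N)\<^bsup>-1\<^esup>\<close> commutes with \<open>N\<close> and \<open>N\<^sup>*\<close>. Since \<open>\<langle>BAx, Ax\<rangle>\<close> is real, \<open>N\<close> is symmetric for
  the positive form \<open>a(x,y) = \<langle>Ax, y\<rangle>\<close>, so \<open>a(x,x) l\<^sup>2 \<le> a((N - il)x, (N - il)x)\<close> for real \<open>l\<close>.
  Near a nonzero approximate eigenvalue of \<open>X = (Im N) T\<^sup>2\<close>, however, \<open>N - il\<close> contracts the Hilbert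
  norm by a factor \<open>< \<bar>l\<bar>\<close> for suitable \<open>l\<close>; iterating, \<open>a\<close> vanishes asymptotically on the
  approximate eigenvectors. The Cauchy-Schwarz inequality for \<open>a\<close> applied to
  \<open>\<parallel>Nx\<parallel>\<^sup>2 = \<langle>Ax, BNx\<rangle>\<close>, where \<open>\<langle>ABNx, BNx\<rangle> = \<langle>N\<^sup>*Nx, BNx\<rangle>\<close> stays bounded, then makes \<open>Nx\<close> vanish
  asymptotically as well, a contradiction. Hence \<open>X = 0\<close>, and \<open>N\<close> is self-adjoint. Neither the
  spectral theorem nor Fuglede's theorem is needed.
\<close>

section \<open>Hilbert space preliminaries\<close>

text \<open>The projection theorem: \<open>s\<close> is the point of \<open>S\<close> nearest to
  \<open>h\<close>. Applied to the graph of an operator, it solves the resolvent equation.\<close>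

lemma closed_subspace_orthogonal_decomposition:
  fixes S :: "'a::{real_inner,complete_space} set"
  assumes S: "closed S" "subspace S"
  obtains s where "s \<in> S" "\<And>x. x \<in> S \<Longrightarrow> inner (h - s) x = 0"
proof -
  define d where "d = infdist h S"
  have ne: "S \<noteq> {}" using subspace_0[OF S(2)] by auto
  have d_le: "d \<le> norm (h - x)" if "x \<in> S" for x
    using infdist_le[OF that, of h] by (simp add: d_def dist_norm)
  have d0: "d \<ge> 0" by (simp add: d_def infdist_nonneg)
  \<comment> \<open>Near-minimizers of the distance. By the parallelogram law the diameters of these
    nested sets tend to 0, so completeness yields a common point.\<close>
  define C where "C n = S \<inter> {x. (norm (h - x))\<^sup>2 \<le> d\<^sup>2 + inverse (Suc n)}" for n
  obtain s where s: "\<And>n. s \<in> C n"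
  proof (rule decreasing_closed_nest[of C])
    show "closed (C n)" for n
      unfolding C_def by (intro closed_Int S closed_Collect_le continuous_intros)
    show "C n \<noteq> {}" for n
    proof -
      have "d < sqrt (d\<^sup>2 + inverse (Suc n))"
        by (rule real_less_rsqrt) (simp del: of_nat_Suc)
      then obtain x where "x \<in> S" "dist h x < sqrt (d\<^sup>2 + inverse (Suc n))"
        using cInf_lessD[of "dist h ` S" "sqrt (d\<^sup>2 + inverse (Suc n))"] ne
        by (auto simp: d_def infdist_def)
      then have "(norm (h - x))\<^sup>2 \<le> (sqrt (d\<^sup>2 + inverse (Suc n)))\<^sup>2"
        by (intro power_mono) (auto simp: dist_norm)
      then show ?thesis using \<open>x \<in> S\<close> by (auto simp: C_def)
    qed
    show "C n \<subseteq> C m" if "m \<le> n" for m n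
    proof -
      have "inverse (real (Suc n)) \<le> inverse (real (Suc m))"
        using that by (intro le_imp_inverse_le) auto
      then show ?thesis by (auto simp: C_def simp del: of_nat_Suc intro: order_trans)
    qed
    show "\<exists>n. \<forall>x\<in>C n. \<forall>y\<in>C n. dist x y < e" if "e > 0" for e
    proof -
      obtain n where n: "inverse (real (Suc n)) < e\<^sup>2 / 4"
        using reals_Archimedean[of "e\<^sup>2 / 4"] \<open>e > 0\<close> by (auto simp del: of_nat_Suc)
      have "dist x y < e" if xy: "x \<in> C n" "y \<in> C n" for x y
      proof -
        have mid: "(1/2) *\<^sub>R (x + y) \<in> S"
          using xy S(2) by (intro subspace_scale subspace_add) (auto simp: C_def)
        have "(norm (x - y))\<^sup>2 + 4 * (norm (h - (1/2) *\<^sub>R (x + y)))\<^sup>2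
            = 2 * (norm (h - x))\<^sup>2 + 2 * (norm (h - y))\<^sup>2"
          by (simp add: power2_norm_eq_inner inner_commute algebra_simps)
        moreover have "d\<^sup>2 \<le> (norm (h - (1/2) *\<^sub>R (x + y)))\<^sup>2"
          using d_le[OF mid] d0 by (intro power_mono) auto
        moreover have "(norm (h - x))\<^sup>2 \<le> d\<^sup>2 + inverse (Suc n)" "(norm (h - y))\<^sup>2 \<le> d\<^sup>2 + inverse (Suc n)"
          using xy by (auto simp: C_def)
        ultimately have "(norm (x - y))\<^sup>2 < e\<^sup>2" using n by linarith
        then show ?thesis using \<open>e > 0\<close> by (simp add: dist_norm power2_less_imp_less)
      qed
      then show ?thesis by blast
    qed
  qed blast
  have sS: "s \<in> S" using s by (auto simp: C_def)
  have "(norm (h - s))\<^sup>2 \<le> d\<^sup>2"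
  proof (rule field_le_epsilon)
    fix e :: real assume "e > 0"
    then obtain n where "inverse (real (Suc n)) < e" using reals_Archimedean by blast
    then show "(norm (h - s))\<^sup>2 \<le> d\<^sup>2 + e" using s[of n] by (auto simp: C_def)
  qed
  then have min: "(norm (h - s))\<^sup>2 \<le> (norm (h - x))\<^sup>2" if "x \<in> S" for x
    using d_le[OF that] d0 by (meson order_trans power_mono)
  have "inner (h - s) x = 0" if x: "x \<in> S" for x
  proof (cases "x = 0")
    case False
    \<comment> \<open>The minimizer of the quadratic \<open>norm (h - s - t x)^2\<close> in
      \<open>t\<close>; minimality of \<open>s\<close> forces the gain to vanish.\<close>
    define t where "t = inner (h - s) x / inner x x"
    have "s + t *\<^sub>R x \<in> S" using x sS S(2) by (intro subspace_add subspace_scale)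
    note min[OF this]
    also have "(norm (h - (s + t *\<^sub>R x)))\<^sup>2
        = (norm (h - s))\<^sup>2 - 2 * t * inner (h - s) x + t\<^sup>2 * inner x x"
      unfolding power2_norm_eq_inner by (simp add: inner_commute algebra_simps power2_eq_square)
    also have "\<dots> = (norm (h - s))\<^sup>2 - (inner (h - s) x)\<^sup>2 / inner x x"
      using False by (simp add: t_def power2_eq_square)
    finally have "(inner (h - s) x)\<^sup>2 / inner x x \<le> 0" by simp
    then show ?thesis using False
      by (simp add: divide_le_0_iff) (metis inner_ge_zero inner_eq_zero_iff order_antisym)
  qed simp
  with sS show ?thesis by (rule that)
qed

text \<open>The uniform boundedness principle for the functionals represented by \<open>W\<close>,
  from Baire's theorem.\<close>

lemma pointwise_bounded_inner_imp_bounded: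
  fixes W :: "'a::{real_inner,complete_space} set"
  assumes pw: "\<And>u. \<exists>c. \<forall>w\<in>W. \<bar>inner u w\<bar> \<le> c"
  obtains K where "\<And>w. w \<in> W \<Longrightarrow> norm w \<le> K"
proof -
  define G where "G n = {u. \<forall>w\<in>W. \<bar>inner u w\<bar> \<le> real n}" for n :: nat
  have "closed (G n)" for n
  proof -
    have "G n = (\<Inter>w\<in>W. {u. \<bar>inner u w\<bar> \<le> real n})" by (auto simp: G_def)
    also have "closed \<dots>" by (intro closed_INT ballI closed_Collect_le continuous_intros)
    finally show ?thesis .
  qed
  moreover have "\<Union>(range G) = UNIV"
  proof -
    have "\<exists>n. u \<in> G n" for u
    proof -
      obtain c where "\<forall>w\<in>W. \<bar>inner u w\<bar> \<le> c" using pw by blast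
      moreover obtain n where "c \<le> real n" using real_arch_simple by blast
      ultimately have "u \<in> G n" by (auto simp: G_def intro: order_trans)
      then show ?thesis ..
    qed
    then show ?thesis by auto
  qed
  moreover have "interior (\<Union>(range G)) = {}" if "\<And>n. interior (G n) = {}"
    using Met_TC.metric_Baire_category_alt[of "range G"] calculation(1) that
    by (auto simp: complete_UNIV)
  ultimately obtain n where "interior (G n) \<noteq> {}" by fastforce
  then obtain u e where e: "e > 0" "ball u e \<subseteq> G n"
    by (metis ex_in_conv mem_interior)
  have "norm w \<le> 4 * n / e" if w: "w \<in> W" for w
  proof (cases "w = 0")
    case False
    \<comment> \<open>Length \<open>e / 2\<close> keeps \<open>u + v\<close> in the ball; comparing
      the bounds at \<open>u\<close> and \<open>u + v\<close> isolates
      \<open>inner v w\<close>.\<close>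
    define v where "v = (e / 2 / norm w) *\<^sub>R w"
    have "u \<in> ball u e" "u + v \<in> ball u e"
      using e False by (auto simp: v_def dist_norm)
    then have "\<bar>inner u w\<bar> \<le> n" "\<bar>inner (u + v) w\<bar> \<le> n"
      using e(2) w unfolding G_def by blast+
    then have "inner v w \<le> 2 * n" by (simp add: inner_add_left)
    also have "inner v w = e / 2 * norm w"
      using False by (simp add: v_def dot_square_norm power2_eq_square)
    finally show ?thesis using e by (simp add: field_simps)
  qed (use e in auto)
  then show ?thesis by (rule that)
qed

text \<open>A Hellinger-Toeplitz argument: the adjoint images \<open>w\<close> of the unit ball of
  \<open>V\<close> satisfy \<open>\<bar>inner u w\<bar> \<le> norm (S u)\<close>, so they are
  pointwise bounded and hence bounded in norm.\<close>

lemma bounded_of_densely_defined_adjoint: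
  fixes S :: "'a::{real_inner,complete_space} \<Rightarrow> 'a"
  assumes dense: "closure V = UNIV" and sub: "subspace V"
    and adj: "\<And>v. v \<in> V \<Longrightarrow> \<exists>w. \<forall>u. inner (S u) v = inner u w"
  obtains K where "\<And>u. norm (S u) \<le> K * norm u"
proof -
  define W where "W = {w. \<exists>v\<in>V. norm v \<le> 1 \<and> (\<forall>u. inner (S u) v = inner u w)}"
  have "\<exists>c. \<forall>w\<in>W. \<bar>inner u w\<bar> \<le> c" for u
  proof (intro exI ballI)
    fix w assume "w \<in> W"
    then obtain v where v: "norm v \<le> 1" "inner (S u) v = inner u w" by (auto simp: W_def)
    then have "\<bar>inner u w\<bar> \<le> norm (S u) * norm v" by (metis Cauchy_Schwarz_ineq2)
    also have "\<dots> \<le> norm (S u)" using v by (simp add: mult_left_le)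
    finally show "\<bar>inner u w\<bar> \<le> norm (S u)" .
  qed
  then obtain K where K: "\<And>w. w \<in> W \<Longrightarrow> norm w \<le> K"
    using pointwise_bounded_inner_imp_bounded by metis
  have V: "inner (S u) v \<le> K * norm u * norm v" if v: "v \<in> V" for u v
  proof (cases "v = 0")
    case False
    define v' where "v' = (1 / norm v) *\<^sub>R v"
    have "v' \<in> V" "norm v' = 1" using v sub False by (auto simp: v'_def subspace_scale)
    then obtain w where w: "\<And>u. inner (S u) v' = inner u w" using adj by blast
    then have "w \<in> W" using \<open>v' \<in> V\<close> \<open>norm v' = 1\<close> by (auto simp: W_def intro!: bexI[of _ v'])
    have "inner (S u) v = norm v * inner (S u) v'" using False by (simp add: v'_def)
    also have "\<dots> \<le> norm v * (norm u * norm w)"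
      unfolding w by (intro mult_left_mono norm_cauchy_schwarz) auto
    also have "\<dots> \<le> norm v * (norm u * K)"
      using K[OF \<open>w \<in> W\<close>] by (intro mult_left_mono) auto
    finally show ?thesis by (simp add: mult_ac)
  qed simp
  have "inner (S u) v \<le> K * norm u * norm v" for u v
  proof -
    have "closed {v. inner (S u) v \<le> K * norm u * norm v}"
      by (intro closed_Collect_le continuous_intros)
    moreover have "V \<subseteq> {v. inner (S u) v \<le> K * norm u * norm v}" using V by auto
    ultimately have "closure V \<subseteq> {v. inner (S u) v \<le> K * norm u * norm v}"
      by (rule closure_minimal [rotated])
    then show ?thesis using dense by auto
  qed
  then have "inner (S u) (S u) \<le> K * norm u * norm (S u)" for u .
  then have "norm (S u) * norm (S u) \<le> K * norm u * norm (S u)" for u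
    by (simp add: dot_square_norm power2_eq_square)
  moreover have "0 \<le> K * norm u" for u
  proof -
    have "0 \<in> W" using sub by (auto simp: W_def intro!: bexI[of _ 0] subspace_0)
    then have "0 \<le> K" using K[of 0] by simp
    then show ?thesis by simp
  qed
  ultimately have "norm (S u) \<le> K * norm u" for u
    by (metis mult_le_cancel_right norm_ge_zero order_less_le norm_eq_zero)
  then show ?thesis by (rule that)
qed

text \<open>If neither \<open>k = onorm X\<close> nor \<open>-k\<close> is an approximate
  eigenvalue, then \<open>X^2 - k^2 = (X - k)(X + k)\<close> is bounded below, which pushes the norm
  of \<open>X\<close> strictly below \<open>k\<close>.\<close>

lemma selfadjoint_quasinilpotent_eq_0:
  fixes X :: "'a::real_inner \<Rightarrow> 'a"
  assumes X: "bounded_linear X" and sa: "\<And>x y. inner (X x) y = inner x (X y)"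
    and below: "\<And>k::real. k \<noteq> 0 \<Longrightarrow> \<exists>c>0. \<forall>y. c * norm y \<le> norm (X y - k *\<^sub>R y)"
  shows "X x = 0"
proof (rule ccontr)
  interpret X: bounded_linear X by fact
  assume "X x \<noteq> 0"
  then have k: "onorm X > 0" using onorm_pos_lt[OF X] by blast
  define k where "k = onorm X"
  have kX: "norm (X y) \<le> k * norm y" for y using onorm[OF X] by (simp add: k_def)
  obtain c1 c2 where c: "c1 > 0" "c2 > 0" "\<And>y. c1 * norm y \<le> norm (X y - k *\<^sub>R y)"
      "\<And>y. c2 * norm y \<le> norm (X y - (- k) *\<^sub>R y)"
    using below[of k] below[of "-k"] k by (auto simp: k_def)
  have eq: "(norm (X y))\<^sup>2 \<le> (k\<^sup>2 - (c1 * c2)\<^sup>2 / k\<^sup>2) * (norm y)\<^sup>2" for y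
  proof -
    have "c1 * (c2 * norm y) \<le> c1 * norm (X y + k *\<^sub>R y)"
      using c(4)[of y] c(1) by (intro mult_left_mono) auto
    also have "\<dots> \<le> norm (X (X y) - k\<^sup>2 *\<^sub>R y)"
      using c(3)[of "X y + k *\<^sub>R y"] by (simp add: X.add X.scaleR algebra_simps power2_eq_square)
    finally have "(c1 * c2 * norm y)\<^sup>2 \<le> (norm (X (X y) - k\<^sup>2 *\<^sub>R y))\<^sup>2"
      using c(1,2) by (intro power_mono) (auto simp: mult_ac)
    \<comment> \<open>Self-adjointness turns the cross term \<open>inner (X (X y)) y\<close> into
      \<open>norm (X y)^2\<close>.\<close>
    also have "\<dots> = (norm (X (X y)))\<^sup>2 - 2 * k\<^sup>2 * (norm (X y))\<^sup>2 + k^4 * (norm y)\<^sup>2"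
      using sa[of "X y" y]
      unfolding power2_norm_eq_inner
      by (simp add: inner_diff_left inner_diff_right inner_commute power4_eq_xxxx
          power2_eq_square algebra_simps)
    also have "(norm (X (X y)))\<^sup>2 \<le> k\<^sup>2 * (norm (X y))\<^sup>2"
      using power_mono[OF kX[of "X y"], of 2] by (simp add: power_mult_distrib)
    finally have "k\<^sup>2 * (norm (X y))\<^sup>2 \<le> k^4 * (norm y)\<^sup>2 - (c1 * c2)\<^sup>2 * (norm y)\<^sup>2"
      by (simp add: power_mult_distrib)
    also have "\<dots> = k\<^sup>2 * ((k\<^sup>2 - (c1 * c2)\<^sup>2 / k\<^sup>2) * (norm y)\<^sup>2)"
      using k by (simp add: k_def field_simps power4_eq_xxxx power2_eq_square)
    finally show ?thesis using k by (simp add: k_def)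
  qed
  have nn: "0 \<le> k\<^sup>2 - (c1 * c2)\<^sup>2 / k\<^sup>2"
    using eq[of x] \<open>X x \<noteq> 0\<close> X.zero
    by (smt (verit) zero_less_power2 mult_neg_pos norm_eq_zero zero_le_power2 mult_nonpos_nonneg)
  have "k \<le> sqrt (k\<^sup>2 - (c1 * c2)\<^sup>2 / k\<^sup>2)"
    unfolding k_def
  proof (rule onorm_bound)
    show "norm (X y) \<le> sqrt ((onorm X)\<^sup>2 - (c1 * c2)\<^sup>2 / (onorm X)\<^sup>2) * norm y" for y
      using real_le_rsqrt[OF eq[of y]] by (simp add: real_sqrt_mult k_def)
  qed (use nn k_def in auto)
  then have "k\<^sup>2 \<le> k\<^sup>2 - (c1 * c2)\<^sup>2 / k\<^sup>2"
    using nn by (metis k k_def less_imp_le power_mono real_sqrt_pow2)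
  then show False using c k by (simp add: k_def divide_le_0_iff)
qed

section \<open>Symmetrizable bounded operators\<close>

text \<open>
  In the application \<open>R = -iNT\<close> and \<open>S = AT\<close>, so that \<open>inner (S x) (T x)\<close> is the form \<open>a\<close> at \<open>T x\<close>.
  The factor \<open>-i\<close> turns the imaginary part of \<open>N\<close> into the real part \<open>D\<close> of \<open>R\<close>, so that
  only the real inner product is involved.
\<close>

locale commuting_symmetrizer =
  fixes T R R' S :: "'a::real_inner \<Rightarrow> 'a" and C :: real
  assumes bounded: "bounded_linear T" "bounded_linear R" "bounded_linear R'" "bounded_linear S"
    and adjoint: "inner (R x) y = inner x (R' y)"
    and T_selfadjoint: "inner (T x) y = inner x (T y)"
    and T_contraction: "norm (T x) \<le> norm x"
    and T_injective: "T x = 0 \<Longrightarrow> x = 0"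
    and commute: "T (R x) = R (T x)" "T (R' x) = R' (T x)" "R (R' x) = R' (R x)"
    and form_symmetric: "inner (S x) (T y) = inner (S y) (T x)"
    and form_shift: "l\<^sup>2 * inner (S (T x)) (T (T x)) \<le> inner (S (R x - l *\<^sub>R T x)) (T (R x - l *\<^sub>R T x))"
    and form_dominates: "norm (R x) ^ 4 \<le> C * inner (S x) (T x) * (norm x)\<^sup>2"
    and C_nonneg: "0 \<le> C"
begin

section \<open>Elementary properties of the real part \<open>D\<close> and of
  \<open>X\<close>\<close>

sublocale T: bounded_linear T by (rule bounded)
sublocale R: bounded_linear R by (rule bounded)
sublocale R': bounded_linear R' by (rule bounded)
sublocale S: bounded_linear S by (rule bounded)

definition q where "q x = inner (S x) (T x)"

definition D where "D x = (1/2) *\<^sub>R (R x + R' x)"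

definition X where "X x = T (D x)"

lemma bounded_linear_D: "bounded_linear D"
  unfolding D_def
  by (intro bounded_linear_scaleR_right[THEN bounded_linear_compose] bounded_linear_add bounded)

sublocale D: bounded_linear D by (rule bounded_linear_D)

lemma bounded_linear_X: "bounded_linear X"
  unfolding X_def by (rule bounded_linear_compose[OF bounded(1) bounded_linear_D])

sublocale X: bounded_linear X by (rule bounded_linear_X)

lemma T_D: "T (D x) = D (T x)" and R_D: "R (D x) = D (R x)"
  by (simp_all add: D_def T.scaleR T.add R.scaleR R.add commute)

lemma D_selfadjoint: "inner (D x) y = inner x (D y)"
proof -
  have "inner (R' x) y = inner x (R y)" by (metis adjoint inner_commute)
  then show ?thesis by (simp add: D_def inner_add_left inner_add_right adjoint)
qed

lemma X_selfadjoint: "inner (X x) y = inner x (X y)"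
  by (simp add: X_def T_D T_selfadjoint D_selfadjoint)

text \<open>\<open>R\<close> commutes with its adjoint, so \<open>R\<close> and \<open>R'\<close>
  have equal norms at each vector.\<close>

lemma norm_D_le: "norm (D x) \<le> norm (R x)"
proof -
  have "inner (R' x) (R' x) = inner (R x) (R x)"
    by (metis adjoint commute(3) inner_commute)
  then have "norm (R' x) = norm (R x)" by (simp add: norm_eq_sqrt_inner)
  then show ?thesis
    using norm_triangle_ineq[of "R x" "R' x"] by (simp add: D_def)
qed

lemma norm_X_le: "norm (X x) \<le> norm (D x)"
  by (simp add: X_def T_contraction)

text \<open>\<open>R\<close> and \<open>R'\<close> pair equally with \<open>T x\<close>, so the skew
  part of \<open>R\<close> drops out.\<close>

lemma inner_R_T: "inner (R x) (T x) = inner (D x) (T x)"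
proof -
  have "inner (R' x) (T x) = inner (R x) (T x)"
    by (metis T_selfadjoint adjoint commute(1) inner_commute)
  then show ?thesis by (simp add: D_def inner_add_left)
qed

text \<open>In the application this is \<open>-i(N - il)\<close> at \<open>X x\<close>; the factor
  \<open>X\<close> makes it bounded.\<close>

definition F where "F l x = R (D x) - l *\<^sub>R X x"

lemma bounded_linear_F: "bounded_linear (F l)"
  unfolding F_def
  by (intro bounded_linear_sub bounded_linear_scaleR_right[THEN bounded_linear_compose]
      bounded_linear_compose[OF bounded(2) bounded_linear_D] bounded_linear_X)

lemma X_F: "X (F l x) = F l (X x)"
  by (simp add: F_def X_def T_D R_D D.diff T.diff D.scaleR T.scaleR commute)

lemma q_F: "l\<^sup>2 * q (X x) \<le> q (F l x)"
  using form_shift[of l "D x"] by (simp add: q_def F_def X_def)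

text \<open>When \<open>X y\<close> is close to \<open>k y\<close>, \<open>q_F\<close> makes the
  form grow under \<open>F l\<close> by at least about \<open>l^2 k^2\<close>, while the squared
  norm grows by at most about \<open>r l^2 k^2\<close> with \<open>r < 1\<close>. This gap is
  iterated later.\<close>

lemma norm_F_contraction:
  fixes k :: real
  assumes "k \<noteq> 0"
  obtains l r c where "l \<noteq> 0" "0 \<le> r" "r < 1" "0 \<le> c"
    "\<And>y. (norm (F l y))\<^sup>2 \<le> r * (l\<^sup>2 * k\<^sup>2) * (norm y)\<^sup>2 + c * norm (X y - k *\<^sub>R y) * norm y"
proof -
  obtain M where M: "\<And>y. norm (R (D y)) \<le> norm y * M" "M > 0"
    using bounded_linear.pos_bounded[OF bounded_linear_compose[OF bounded(2) bounded_linear_D]]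
    by (auto simp: o_def)
  obtain a where a: "\<And>y. norm (D (D y)) \<le> norm y * a" "a > 0"
    using bounded_linear.pos_bounded[OF bounded_linear_compose[OF bounded_linear_D bounded_linear_D]]
    by (auto simp: o_def)
  obtain b where b: "\<And>y. norm (X y) \<le> norm y * b" "b > 0"
    using X.pos_bounded by auto
  \<comment> \<open>With \<open>X y \<approx> k y\<close>, the term \<open>- 2 l \<langle>D D y, X y\<rangle>\<close> in \<open>\<parallel>F l y\<parallel>\<^sup>2\<close> is at most \<open>- 2 l k\<^sup>3 \<parallel>y\<parallel>\<^sup>2\<close>,
    and \<open>l\<close> is chosen so that it outweighs \<open>\<parallel>R D y\<parallel>\<^sup>2 \<le> M\<^sup>2 \<parallel>y\<parallel>\<^sup>2\<close>.\<close>
  define l where "l = (M\<^sup>2 + 1) / k^3"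
  have lk: "l * k > 0"
  proof -
    have "l * k = (M\<^sup>2 + 1) / k\<^sup>2" using assms by (simp add: l_def power3_eq_cube power2_eq_square)
    then show ?thesis using assms by (simp add: sum_power2_gt_zero_iff add_nonneg_pos)
  qed
  have lk3: "l * k^3 = M\<^sup>2 + 1" using assms by (simp add: l_def)
  \<comment> \<open>The coefficient of \<open>norm y ^ 2\<close> found below is
    \<open>l^2 k^2 - (M^2 + 2)\<close>; \<open>r\<close> is its ratio to \<open>l^2 k^2\<close>, cut
    off at 0 because it may be negative.\<close>
  define r where "r = max 0 (1 - (M\<^sup>2 + 2) / (l\<^sup>2 * k\<^sup>2))"
  define c where "c = 2 * \<bar>l\<bar> * a + \<bar>l\<^sup>2 - 2 * (l * k)\<bar> * (b + \<bar>k\<bar>)"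
  have l0: "l \<noteq> 0" using lk by auto
  show thesis
  proof (rule that[of l r c])
    show "l \<noteq> 0" by fact
    show "0 \<le> r" by (simp add: r_def)
    have "(M\<^sup>2 + 2) / (l\<^sup>2 * k\<^sup>2) > 0" using l0 assms by (auto intro!: divide_pos_pos add_nonneg_pos)
    then show "r < 1" by (simp add: r_def)
    show "0 \<le> c" using a b by (simp add: c_def)
    fix y
    define e where "e = norm (X y - k *\<^sub>R y)"
    have Xy: "\<bar>(norm (X y))\<^sup>2 - k\<^sup>2 * (norm y)\<^sup>2\<bar> \<le> (b + \<bar>k\<bar>) * e * norm y"
    proof -
      have "(norm (X y))\<^sup>2 - k\<^sup>2 * (norm y)\<^sup>2 = inner (X y - k *\<^sub>R y) (X y + k *\<^sub>R y)"
        unfolding power2_norm_eq_inner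
        by (simp add: inner_diff_left inner_add_right inner_commute power2_eq_square algebra_simps)
      also have "\<bar>\<dots>\<bar> \<le> e * norm (X y + k *\<^sub>R y)"
        unfolding e_def by (rule Cauchy_Schwarz_ineq2)
      also have "\<dots> \<le> e * (norm y * b + \<bar>k\<bar> * norm y)"
        using norm_triangle_ineq[of "X y" "k *\<^sub>R y"] b(1)[of y]
        by (intro mult_left_mono) (auto simp: e_def)
      finally show ?thesis by (simp add: algebra_simps)
    qed
    \<comment> \<open>Replaces \<open>X y\<close> by \<open>k y\<close>, using that
      \<open>inner (D (D y)) y\<close> is \<open>norm (D y) ^ 2\<close>.\<close>
    have "inner (D (D y)) (X y) = k * (norm (D y))\<^sup>2 + inner (D (D y)) (X y - k *\<^sub>R y)"
      by (simp add: inner_diff_right power2_norm_eq_inner D_selfadjoint)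
    then have "l * inner (D (D y)) (X y)
        = l * k * (norm (D y))\<^sup>2 + l * inner (D (D y)) (X y - k *\<^sub>R y)"
      by (metis distrib_left mult.assoc)
    moreover have "\<bar>inner (D (D y)) (X y - k *\<^sub>R y)\<bar> \<le> a * norm y * e"
    proof -
      have "\<bar>inner (D (D y)) (X y - k *\<^sub>R y)\<bar> \<le> norm (D (D y)) * e"
        unfolding e_def by (rule Cauchy_Schwarz_ineq2)
      also have "\<dots> \<le> (norm y * a) * e" using a(1)[of y] by (intro mult_right_mono) (auto simp: e_def)
      finally show ?thesis by (simp add: mult_ac)
    qed
    then have "\<bar>l * inner (D (D y)) (X y - k *\<^sub>R y)\<bar> \<le> \<bar>l\<bar> * (a * norm y * e)"
      by (simp add: abs_mult mult_left_mono)
    \<comment> \<open>\<open>l\<close> has the sign of \<open>k\<close>, so multiplying by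
      \<open>l * k\<close> preserves the inequality.\<close>
    moreover have "l * k * (norm (X y))\<^sup>2 \<le> l * k * (norm (D y))\<^sup>2"
      using lk norm_X_le[of y] by (intro mult_left_mono power_mono) auto
    ultimately have mid: "l * inner (D (D y)) (X y) \<ge> l * k * (norm (X y))\<^sup>2 - \<bar>l\<bar> * (a * norm y * e)"
      by linarith
    have "(norm (F l y))\<^sup>2 = (norm (R (D y)))\<^sup>2 - 2 * (l * inner (R (D y)) (X y)) + l\<^sup>2 * (norm (X y))\<^sup>2"
      unfolding F_def power2_norm_eq_inner
      by (simp add: inner_diff_left inner_diff_right inner_commute power2_eq_square algebra_simps)
    also have "inner (R (D y)) (X y) = inner (D (D y)) (X y)"
      using inner_R_T[of "D y"] by (simp add: X_def)
    also have "(norm (R (D y)))\<^sup>2 \<le> M\<^sup>2 * (norm y)\<^sup>2"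
      using power_mono[OF M(1)[of y], of 2] by (simp add: power_mult_distrib mult_ac)
    finally have "(norm (F l y))\<^sup>2 \<le> M\<^sup>2 * (norm y)\<^sup>2 + (l\<^sup>2 - 2 * (l * k)) * (norm (X y))\<^sup>2
        + 2 * \<bar>l\<bar> * a * (e * norm y)"
      using mid by (simp add: algebra_simps)
    also have "(l\<^sup>2 - 2 * (l * k)) * (norm (X y))\<^sup>2 \<le> (l\<^sup>2 - 2 * (l * k)) * (k\<^sup>2 * (norm y)\<^sup>2)
        + \<bar>l\<^sup>2 - 2 * (l * k)\<bar> * ((b + \<bar>k\<bar>) * e * norm y)"
    proof -
      have "(l\<^sup>2 - 2 * (l * k)) * ((norm (X y))\<^sup>2 - k\<^sup>2 * (norm y)\<^sup>2)
          \<le> \<bar>l\<^sup>2 - 2 * (l * k)\<bar> * \<bar>(norm (X y))\<^sup>2 - k\<^sup>2 * (norm y)\<^sup>2\<bar>"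
        by (metis abs_ge_self abs_mult)
      also have "\<dots> \<le> \<bar>l\<^sup>2 - 2 * (l * k)\<bar> * ((b + \<bar>k\<bar>) * e * norm y)"
        using Xy by (intro mult_left_mono) auto
      finally show ?thesis by (simp add: right_diff_distrib)
    qed
    also have "M\<^sup>2 * (norm y)\<^sup>2 + ((l\<^sup>2 - 2 * (l * k)) * (k\<^sup>2 * (norm y)\<^sup>2)
          + \<bar>l\<^sup>2 - 2 * (l * k)\<bar> * ((b + \<bar>k\<bar>) * e * norm y)) + 2 * \<bar>l\<bar> * a * (e * norm y)
        = (M\<^sup>2 + l\<^sup>2 * k\<^sup>2 - 2 * (l * k^3)) * (norm y)\<^sup>2 + c * e * norm y"
      by (simp add: c_def algebra_simps power2_eq_square power3_eq_cube)
    also have "M\<^sup>2 + l\<^sup>2 * k\<^sup>2 - 2 * (l * k^3) = (1 - (M\<^sup>2 + 2) / (l\<^sup>2 * k\<^sup>2)) * (l\<^sup>2 * k\<^sup>2)"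
      using l0 assms unfolding lk3 by (simp add: field_simps)
    also have "(1 - (M\<^sup>2 + 2) / (l\<^sup>2 * k\<^sup>2)) * (l\<^sup>2 * k\<^sup>2) * (norm y)\<^sup>2 \<le> r * (l\<^sup>2 * k\<^sup>2) * (norm y)\<^sup>2"
      by (intro mult_right_mono) (auto simp: r_def)
    finally show "(norm (F l y))\<^sup>2 \<le> r * (l\<^sup>2 * k\<^sup>2) * (norm y)\<^sup>2 + c * norm (X y - k *\<^sub>R y) * norm y"
      by (simp add: e_def)
  qed
qed

text \<open>Difference of squares for a symmetric form: the defect pairs \<open>X y - k y\<close>
  with \<open>X y + k y\<close>.\<close>

lemma q_X_approx:
  obtains c where "0 \<le> c" "\<And>y. k\<^sup>2 * q y \<le> q (X y) + c * norm (X y - k *\<^sub>R y) * norm y"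
proof -
  obtain a where a: "\<And>y. norm (S y) \<le> norm y * a" "a > 0"
    using S.pos_bounded by auto
  obtain b where b: "\<And>y. norm (X y) \<le> norm y * b" "b > 0"
    using X.pos_bounded by auto
  show thesis
  proof (rule that[of "a * (b + \<bar>k\<bar>)"])
    show "0 \<le> a * (b + \<bar>k\<bar>)" using a b by simp
    fix y
    have "k\<^sup>2 * q y - q (X y) = - inner (S (X y - k *\<^sub>R y)) (T (X y + k *\<^sub>R y))"
      using form_symmetric[of y "X y"]
      by (simp add: q_def S.diff S.scaleR T.add T.scaleR inner_diff_left inner_add_right
          power2_eq_square algebra_simps)
    also have "\<dots> \<le> norm (S (X y - k *\<^sub>R y)) * norm (T (X y + k *\<^sub>R y))"
      by (metis Cauchy_Schwarz_ineq2 abs_ge_minus_self order_trans)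
    also have "\<dots> \<le> (norm (X y - k *\<^sub>R y) * a) * ((b + \<bar>k\<bar>) * norm y)"
    proof (intro mult_mono a)
      have "norm (T (X y + k *\<^sub>R y)) \<le> norm (X y + k *\<^sub>R y)" by (rule T_contraction)
      also have "\<dots> \<le> norm y * b + \<bar>k\<bar> * norm y"
        using norm_triangle_ineq[of "X y" "k *\<^sub>R y"] b(1)[of y] by simp
      finally show "norm (T (X y + k *\<^sub>R y)) \<le> (b + \<bar>k\<bar>) * norm y" by (simp add: algebra_simps)
    qed (use a in auto)
    finally show "k\<^sup>2 * q y \<le> q (X y) + a * (b + \<bar>k\<bar>) * norm (X y - k *\<^sub>R y) * norm y"
      by (simp add: algebra_simps)
  qed
qed

text \<open>\<open>F l\<close> commutes with \<open>X\<close>, so it preserves approximate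
  eigenvectors, and each application gains a factor \<open>r\<close>. The constant \<open>c\<close>
  may depend on \<open>e\<close> but not on \<open>y\<close>.\<close>

lemma q_small_on_approximate_eigenvectors:
  fixes k e :: real
  assumes k: "k \<noteq> 0" and e: "e > 0"
  obtains c where "0 \<le> c" "\<And>y. q y \<le> e * (norm y)\<^sup>2 + c * norm (X y - k *\<^sub>R y) * norm y"
proof -
  obtain l r c1 where l: "l \<noteq> 0" and r: "0 \<le> r" "r < 1" and c1: "0 \<le> c1"
    "\<And>y. (norm (F l y))\<^sup>2 \<le> r * (l\<^sup>2 * k\<^sup>2) * (norm y)\<^sup>2 + c1 * norm (X y - k *\<^sub>R y) * norm y"
    using norm_F_contraction[OF k] by metis
  obtain c2 where c2: "0 \<le> c2" "\<And>y. k\<^sup>2 * q y \<le> q (X y) + c2 * norm (X y - k *\<^sub>R y) * norm y"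
    using q_X_approx by metis
  obtain f where f: "\<And>y. norm (F l y) \<le> norm y * f" "f > 0"
    using bounded_linear.pos_bounded[OF bounded_linear_F] by metis
  obtain a where a: "\<And>y. norm (S y) \<le> norm y * a" "a > 0"
    using S.pos_bounded by auto
  interpret F: bounded_linear "F l" by (rule bounded_linear_F)
  \<comment> \<open>Any bound \<open>q y \<le> s \<parallel>y\<parallel>\<^sup>2\<close>, up to a multiple of \<open>\<parallel>X y - k y\<parallel> \<parallel>y\<parallel>\<close>, improves to \<open>s r\<close> when
    applied to \<open>F l y\<close>, because \<open>l\<^sup>2 k\<^sup>2 q y \<approx> l\<^sup>2 q (X y) \<le> q (F l y)\<close>.\<close>
  have "\<exists>c\<ge>0. \<forall>y. q y \<le> a * r ^ n * (norm y)\<^sup>2 + c * norm (X y - k *\<^sub>R y) * norm y" for n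
  proof (induction n)
    case 0
    have "q y \<le> a * (norm y)\<^sup>2" for y
    proof -
      have "q y \<le> norm (S y) * norm (T y)" unfolding q_def by (rule norm_cauchy_schwarz)
      also have "\<dots> \<le> (norm y * a) * norm y" using a by (intro mult_mono T_contraction) auto
      finally show ?thesis by (simp add: power2_eq_square mult_ac)
    qed
    then show ?case by (intro exI[of _ 0]) auto
  next
    case (Suc n)
    then obtain c where c: "0 \<le> c"
      "\<And>y. q y \<le> a * r ^ n * (norm y)\<^sup>2 + c * norm (X y - k *\<^sub>R y) * norm y" by auto
    define s where "s = a * r ^ n"
    have s: "s \<ge> 0" using a r by (simp add: s_def)
    \<comment> \<open>Collects the errors from \<open>q_X_approx\<close>, from the contraction
      estimate and from the induction hypothesis at \<open>F l y\<close>, divided by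
      \<open>l^2 k^2\<close>.\<close>
    define c' where "c' = (l\<^sup>2 * c2 + s * c1 + c * f\<^sup>2) / (l\<^sup>2 * k\<^sup>2)"
    have "q y \<le> a * r ^ Suc n * (norm y)\<^sup>2 + c' * norm (X y - k *\<^sub>R y) * norm y" for y
    proof -
      define d where "d = norm (X y - k *\<^sub>R y)"
      have "l\<^sup>2 * k\<^sup>2 * q y \<le> l\<^sup>2 * q (X y) + l\<^sup>2 * c2 * d * norm y"
        using mult_left_mono[OF c2(2)[of y], of "l\<^sup>2"] by (simp add: d_def algebra_simps)
      also have "l\<^sup>2 * q (X y) \<le> q (F l y)" by (rule q_F)
      also have "q (F l y) \<le> s * (norm (F l y))\<^sup>2 + c * (norm (X (F l y) - k *\<^sub>R F l y) * norm (F l y))"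
        using c(2)[of "F l y"] by (simp add: s_def mult_ac)
      also have "norm (X (F l y) - k *\<^sub>R F l y) * norm (F l y) \<le> (d * f) * (norm y * f)"
        using f(1)[of "X y - k *\<^sub>R y"] f(1)[of y] f(2)
        by (intro mult_mono) (auto simp: X_F F.diff F.scaleR d_def)
      also have "(norm (F l y))\<^sup>2 \<le> r * (l\<^sup>2 * k\<^sup>2) * (norm y)\<^sup>2 + c1 * d * norm y"
        unfolding d_def by (rule c1)
      finally have "l\<^sup>2 * k\<^sup>2 * q y \<le> s * (r * (l\<^sup>2 * k\<^sup>2) * (norm y)\<^sup>2 + c1 * d * norm y)
          + c * (d * f * (norm y * f)) + l\<^sup>2 * c2 * d * norm y"
        using s c(1) by (simp add: mult_left_mono)
      also have "\<dots> = l\<^sup>2 * k\<^sup>2 * (a * r ^ Suc n * (norm y)\<^sup>2 + c' * d * norm y)"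
        using l k by (simp add: c'_def s_def field_simps power2_eq_square)
      finally show ?thesis using l k by (simp add: d_def)
    qed
    moreover have "c' \<ge> 0" using s c c1 c2 by (simp add: c'_def)
    ultimately show ?case by blast
  qed
  moreover obtain n where n: "a * r ^ n \<le> e"
  proof -
    have "(\<lambda>n. a * r ^ n) \<longlonglongrightarrow> a * 0"
      using r by (intro tendsto_intros LIMSEQ_power_zero) auto
    then have "\<forall>\<^sub>F n in sequentially. a * r ^ n < e" using e by (intro order_tendstoD) auto
    then obtain n where "a * r ^ n < e" by (auto simp: eventually_sequentially)
    then show ?thesis by (intro that[of n]) simp
  qed
  ultimately obtain c where "0 \<le> c"
    "\<And>y. q y \<le> a * r ^ n * (norm y)\<^sup>2 + c * norm (X y - k *\<^sub>R y) * norm y" by blast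
  moreover have "a * r ^ n * (norm y)\<^sup>2 \<le> e * (norm y)\<^sup>2" for y
    using n by (intro mult_right_mono) auto
  ultimately show thesis by (intro that[of c]) (auto intro: order_trans[OF _ add_right_mono])
qed

text \<open>For an approximate eigenvector, \<open>norm (R y)\<close> is at least
  \<open>\<bar>k\<bar> / 2 * norm y\<close>, which \<open>form_dominates\<close> excludes once
  \<open>q y\<close> is small.\<close>

lemma X_bounded_below:
  fixes k :: real
  assumes k: "k \<noteq> 0"
  shows "\<exists>c>0. \<forall>y. c * norm y \<le> norm (X y - k *\<^sub>R y)"
proof -
  \<comment> \<open>The lower bound \<open>(k/2)^4 = k^4/16\<close> is split into two halves
    \<open>k^4/32\<close>, one for \<open>C * e\<close> and one for \<open>C * c * m\<close>; the
    added 1 keeps the denominators positive.\<close>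
  define e where "e = k^4 / (32 * (C + 1))"
  have k4: "k^4 > 0" using k by simp
  have e: "e > 0" using k4 C_nonneg by (simp add: e_def)
  obtain c where c: "0 \<le> c" "\<And>y. q y \<le> e * (norm y)\<^sup>2 + c * norm (X y - k *\<^sub>R y) * norm y"
    using q_small_on_approximate_eigenvectors[OF k e] by metis
  define m where "m = min (\<bar>k\<bar> / 2) (k^4 / (32 * (C * c + 1)))"
  have "m > 0" using k k4 C_nonneg c by (simp add: m_def add_nonneg_pos)
  moreover have "m * norm y \<le> norm (X y - k *\<^sub>R y)" for y
  proof (rule ccontr)
    assume contra: "\<not> m * norm y \<le> norm (X y - k *\<^sub>R y)"
    define d where "d = norm (X y - k *\<^sub>R y)"
    have d: "d < m * norm y" using contra by (simp add: d_def)
    have y: "norm y > 0" using d by (smt (verit) d_def mult_eq_0_iff norm_ge_zero)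
    have "m * norm y \<le> \<bar>k\<bar> / 2 * norm y"
      unfolding m_def by (intro mult_right_mono min.cobounded1) auto
    then have "\<bar>k\<bar> / 2 * norm y \<le> \<bar>k\<bar> * norm y - d" using d by simp
    also have "\<dots> \<le> norm (X y)"
      using norm_triangle_ineq2[of "k *\<^sub>R y" "X y"] by (simp add: d_def norm_minus_commute)
    also have "\<dots> \<le> norm (R y)" using norm_X_le norm_D_le order_trans by blast
    finally have "(\<bar>k\<bar> / 2 * norm y)^4 \<le> norm (R y)^4" by (intro power_mono) auto
    also have "\<dots> \<le> C * q y * (norm y)\<^sup>2" using form_dominates by (simp add: q_def)
    also have "\<dots> \<le> C * (e * (norm y)\<^sup>2 + c * d * norm y) * (norm y)\<^sup>2"
      using c(2)[of y] C_nonneg by (intro mult_left_mono mult_right_mono) (auto simp: d_def)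
    finally have "k^4 / 16 * norm y * norm y ^ 3 \<le> (C * e * norm y + C * c * d) * norm y ^ 3"
      by (simp add: power_mult_distrib power_divide power4_eq_xxxx power2_eq_square power3_eq_cube
          algebra_simps)
    then have "k^4 / 16 * norm y \<le> C * e * norm y + C * c * d"
      using y by (simp add: mult_le_cancel_right)
    moreover have "C * e * norm y \<le> k^4 / 32 * norm y"
      using C_nonneg k4 by (intro mult_right_mono) (auto simp: e_def field_simps)
    moreover have p: "C * c + 1 > 0" using C_nonneg c by (simp add: add_nonneg_pos)
    have "C * c * d < k^4 / 32 * norm y"
    proof -
      have "C * c * d \<le> (C * c + 1) * d" by (simp add: d_def algebra_simps)
      also have "\<dots> < (C * c + 1) * (m * norm y)"
        using d p by (intro mult_strict_left_mono)
      also have "\<dots> \<le> (C * c + 1) * (k^4 / (32 * (C * c + 1)) * norm y)"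
        using C_nonneg c unfolding m_def
          by (intro mult_left_mono mult_right_mono min.cobounded2) auto
      also have "\<dots> = k^4 / 32 * norm y"
        using p by (simp add: field_simps)
      finally show ?thesis .
    qed
    ultimately show False by simp
  qed
  ultimately show ?thesis by blast
qed

lemma real_part_eq_0: "R x + R' x = 0"
proof -
  have "X x = 0"
    by (rule selfadjoint_quasinilpotent_eq_0[OF bounded_linear_X X_selfadjoint X_bounded_below])
  then have "D x = 0" by (auto simp: X_def dest: T_injective)
  then show ?thesis by (simp add: D_def)
qed

end

section \<open>Complex scalars and adjoints\<close>

lemma scaleC_minus_one: "(- 1) *\<^sub>C x = - x"
  using scaleC_of_real[of "-1" x] by simp

lemma scaleC_minus_left: "(- c) *\<^sub>C x = - (c *\<^sub>C x)"
  by (metis mult_minus1 scaleC_minus_one scaleC_scaleC)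

lemma scaleC_minus_right: "c *\<^sub>C (- x) = - (c *\<^sub>C x)"
  by (metis mult.commute scaleC_minus_one scaleC_scaleC)

lemma scaleC_scaleR_commute: "c *\<^sub>C (r *\<^sub>R x) = r *\<^sub>R (c *\<^sub>C x)"
  by (metis mult.commute scaleC_of_real scaleC_scaleC)

lemma ii_ii: "\<i> *\<^sub>C \<i> *\<^sub>C x = - x"
  by (simp add: scaleC_scaleC scaleC_minus_one)

lemma cinner_scaleC_right: "cinner x (c *\<^sub>C y) = cnj c * cinner x y"
  by (metis cinner_commute cinner_scaleC_left complex_cnj_mult)

lemma inner_ii_left: "inner (\<i> *\<^sub>C x) y = - inner x (\<i> *\<^sub>C y)"
  by (simp add: Re_cinner[symmetric] cinner_scaleC_left cinner_scaleC_right)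

lemma norm_ii: "norm (\<i> *\<^sub>C x) = norm x"
  by (simp add: norm_eq_sqrt_inner inner_ii_left ii_ii)

lemma Im_cinner: "Im (cinner x y) = - inner (\<i> *\<^sub>C x) y"
  by (simp add: Re_cinner[symmetric] cinner_scaleC_left)

lemma cinner_eq_iff: "cinner x y = cinner u v \<longleftrightarrow>
    inner x y = inner u v \<and> inner (\<i> *\<^sub>C x) y = inner (\<i> *\<^sub>C u) v"
  by (simp add: complex_eq_iff Re_cinner Im_cinner)

lemma linear_opD:
  assumes "linear_op T"
  shows "T 0 = Some 0"
    and "T x = Some u \<Longrightarrow> T y = Some v \<Longrightarrow> T (x + y) = Some (u + v)"
    and "T x = Some u \<Longrightarrow> T (c *\<^sub>C x) = Some (c *\<^sub>C u)"
    and "T x = Some u \<Longrightarrow> T (r *\<^sub>R x) = Some (r *\<^sub>R u)"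
    and "T x = Some u \<Longrightarrow> T y = Some v \<Longrightarrow> T (x - y) = Some (u - v)"
proof -
  show c: "T x = Some u \<Longrightarrow> T (c *\<^sub>C x) = Some (c *\<^sub>C u)" for c x u
    using assms by (auto simp: linear_op_def)
  show a: "T x = Some u \<Longrightarrow> T y = Some v \<Longrightarrow> T (x + y) = Some (u + v)" for x y u v
    using assms by (auto simp: linear_op_def)
  show "T 0 = Some 0" using assms by (auto simp: linear_op_def)
  show "T x = Some u \<Longrightarrow> T (r *\<^sub>R x) = Some (r *\<^sub>R u)"
    using c[of x u "complex_of_real r"] by (simp add: scaleC_of_real)
  show "T x = Some u \<Longrightarrow> T y = Some v \<Longrightarrow> T (x - y) = Some (u - v)"
    using a[of x u "- y" "- v"] c[of y v "- 1"] by (simp add: scaleC_minus_one)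
qed

text \<open>The domain is stable under \<open>\<i>\<close>, so the real identity at
  \<open>\<i> *\<^sub>C x\<close> supplies the imaginary part.\<close>

lemma adj_op_eq_Some_iff_inner:
  assumes "densely_defined T"
  shows "adj_op T y = Some z \<longleftrightarrow> (\<forall>x u. T x = Some u \<longrightarrow> inner u y = inner x z)"
proof -
  have lin: "linear_op T" using assms by (simp add: densely_defined_def)
  show ?thesis
    unfolding adj_op_eq_Some_iff[OF assms] cinner_eq_iff
    using linear_opD(3)[OF lin, of _ _ \<i>] by blast
qed

lemma linear_op_adj_op:
  assumes "densely_defined T"
  shows "linear_op (adj_op T)"
  unfolding linear_op_def adj_op_eq_Some_iff[OF assms]
  by (auto simp: cinner_scaleC_right cinner_eq_iff inner_add_right)

section \<open>The resolvent of a normal operator\<close>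

locale normal_operator =
  fixes N :: "'a::chilbert_space \<rightharpoonup> 'a"
  assumes normal: "normal_op N"
begin

abbreviation "N' \<equiv> adj_op N"

lemma densely_defined: "densely_defined N"
  and closed: "closed (Map.graph N)"
  and comp_eq: "N \<circ>\<^sub>m N' = N' \<circ>\<^sub>m N"
  using normal by (auto simp: normal_op_def closed_op_def)

lemma linear: "linear_op N"
  using densely_defined by (simp add: densely_defined_def)

lemma linear': "linear_op N'"
  by (rule linear_op_adj_op[OF densely_defined])

lemmas lin = linear_opD[OF linear]
lemmas lin' = linear_opD[OF linear']

lemma adj: "N x = Some u \<Longrightarrow> N' y = Some z \<Longrightarrow> inner u y = inner x z"
  using adj_op_eq_Some_iff_inner[OF densely_defined] by blast

lemma normalD: "N' x = Some y \<Longrightarrow> N y = Some z \<Longrightarrow> \<exists>w. N x = Some w \<and> N' w = Some z"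
  using fun_cong[OF comp_eq, of x] by (auto simp: map_comp_def split: option.splits)

text \<open>The quadratic form of \<open>1 + N'N\<close> is
  \<open>norm x ^ 2 + norm (N x) ^ 2\<close>, so its kernel is trivial.\<close>

lemma resolvent_unique:
  assumes "N x = Some y" "N' y = Some z" "N x' = Some y'" "N' y' = Some z'" "x + z = x' + z'"
  shows "x = x'"
proof -
  have N: "N (x - x') = Some (y - y')" "N' (y - y') = Some (z - z')"
    using assms lin(5) lin'(5) by blast+
  have "inner (x - x') (x - x') + inner (y - y') (y - y') = inner (x - x') ((x + z) - (x' + z'))"
    unfolding adj[OF N] by (simp add: inner_diff_right inner_add_right)
  also have "\<dots> = 0" using assms(5) by simp
  finally have "inner (x - x') (x - x') = 0"
    by (metis add_nonneg_eq_0_iff inner_ge_zero)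
  then show ?thesis by simp
qed

text \<open>Von Neumann's argument: project \<open>(h, 0)\<close> onto the closed graph of
  \<open>N\<close>. Orthogonality of the residual \<open>(h - x, -y)\<close> to the graph says that
  \<open>N' y = h - x\<close>.\<close>

lemma resolvent_exists: "\<exists>x y. N x = Some y \<and> N' y = Some (h - x)"
proof -
  have "subspace (Map.graph N)"
    using lin(1,2,4) by (auto simp: subspace_def graph_def zero_prod_def)
  then obtain s where s: "s \<in> Map.graph N"
    "\<And>p. p \<in> Map.graph N \<Longrightarrow> inner ((h, 0) - s) p = 0"
    using closed_subspace_orthogonal_decomposition[OF closed, of "(h, 0)"] by blast
  obtain x y where sxy: "s = (x, y)" by (cases s)
  have xy: "N x = Some y" "\<And>u v. N u = Some v \<Longrightarrow> inner ((h, 0) - (x, y)) (u, v) = 0"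
    using s by (auto simp: graph_def sxy)
  have "N' y = Some (h - x)"
    unfolding adj_op_eq_Some_iff_inner[OF densely_defined]
    using xy(2) by (auto simp: inner_commute)
  then show ?thesis using xy(1) by blast
qed

text \<open>\<open>T = (1 + N\<^sup>*N)\<^bsup>-1\<^esup>\<close>\<close>

definition T where "T h = (SOME x. \<exists>y. N x = Some y \<and> N' y = Some (h - x))"

definition P where "P h = the (N (T h))"

definition P' where "P' h = the (N' (T h))"

lemma N_T: "N (T h) = Some (P h)" and N'_P: "N' (P h) = Some (h - T h)"
proof -
  have "\<exists>y. N (T h) = Some y \<and> N' y = Some (h - T h)"
    unfolding T_def by (rule someI_ex[OF resolvent_exists])
  then show "N (T h) = Some (P h)" "N' (P h) = Some (h - T h)" by (auto simp: P_def)
qed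

text \<open>Normality moves \<open>T h\<close> from the domain of \<open>N'N\<close> to that of
  \<open>NN'\<close>.\<close>

lemma N'_T: "N' (T h) = Some (P' h)" and N_P': "N (P' h) = Some (h - T h)"
proof -
  have "(N \<circ>\<^sub>m N') (T h) = Some (h - T h)"
    unfolding comp_eq by (simp add: map_comp_def N_T N'_P)
  then show "N' (T h) = Some (P' h)" "N (P' h) = Some (h - T h)"
    by (auto simp: map_comp_def P'_def split: option.splits)
qed

lemma T_eqI:
  assumes "N x = Some y" "N' y = Some z" "h = x + z"
  shows "T h = x"
  by (rule resolvent_unique[OF N_T N'_P assms(1,2)]) (simp add: assms)

text \<open>\<open>N\<close> maps \<open>x - T x = N' (P x)\<close> to \<open>y - P x\<close>; by
  normality \<open>N'N (P x) = y - P x\<close>, so \<open>P x\<close> solves the equation defining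
  \<open>T y\<close>. Thus \<open>T\<close> commutes with \<open>N\<close>.\<close>

lemma P_eq:
  assumes "N x = Some y"
  shows "P x = T y"
proof -
  have "N (x - T x) = Some (y - P x)" using assms N_T by (rule lin)
  from normalD[OF N'_P this] obtain w where "N (P x) = Some w" "N' w = Some (y - P x)" by blast
  then show ?thesis by (intro T_eqI[symmetric]) auto
qed

lemma P'_eq:
  assumes "N' x = Some y"
  shows "P' x = T y"
proof -
  have "N' (x - T x) = Some (y - P' x)" using assms N'_T by (rule lin')
  then show ?thesis by (intro T_eqI[OF N_P', symmetric]) auto
qed

section \<open>Commutation, linearity and bounds for \<open>T\<close>, \<open>P\<close> and
  \<open>P'\<close>\<close>

lemma T_P: "T (P x) = P (T x)" and T_P': "T (P' x) = P' (T x)" and P_P': "P (P' x) = P' (P x)"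
  using P_eq[OF N_T] P'_eq[OF N'_T] P_eq[OF N_P'] P'_eq[OF N'_P] by simp_all

lemma T_add: "T (x + y) = T x + T y"
  by (rule T_eqI[OF lin(2)[OF N_T N_T] lin'(2)[OF N'_P N'_P]]) simp

lemma T_scaleC: "T (c *\<^sub>C x) = c *\<^sub>C T x"
  by (rule T_eqI[OF lin(3)[OF N_T] lin'(3)[OF N'_P]]) (simp add: scaleC_add_right[symmetric])

lemma P_add: "P (x + y) = P x + P y"
  using lin(2)[OF N_T N_T, of x y] N_T[of "x + y"] by (simp add: T_add)

lemma P_scaleC: "P (c *\<^sub>C x) = c *\<^sub>C P x"
  using lin(3)[OF N_T, of c x] N_T[of "c *\<^sub>C x"] by (simp add: T_scaleC)

lemma P'_add: "P' (x + y) = P' x + P' y"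
  using lin'(2)[OF N'_T N'_T, of x y] N'_T[of "x + y"] by (simp add: T_add)

lemma P'_scaleC: "P' (c *\<^sub>C x) = c *\<^sub>C P' x"
  using lin'(3)[OF N'_T, of c x] N'_T[of "c *\<^sub>C x"] by (simp add: T_scaleC)

text \<open>Expand \<open>x = T x + (x - T x)\<close>; since \<open>x - T x = N' (P x)\<close>, the
  cross term is \<open>norm (P x) ^ 2\<close>.\<close>

lemma norm_square_decomp: "(norm x)\<^sup>2 = (norm (T x))\<^sup>2 + 2 * (norm (P x))\<^sup>2 + (norm (x - T x))\<^sup>2"
  using adj[OF N_T N'_P, of x x] unfolding power2_norm_eq_inner
  by (simp add: inner_diff_left inner_diff_right inner_commute)

lemma norm_P': "norm (P' x) = norm (P x)"
  using adj[OF N_T N'_P, of x x] adj[OF N_P' N'_T, of x x]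
  by (simp add: norm_eq_sqrt_inner inner_commute)

lemma norm_T_le: "norm (T x) \<le> norm x" and norm_P_le: "norm (P x) \<le> norm x"
  and norm_diff_T_le: "norm (x - T x) \<le> norm x"
  using norm_square_decomp[of x] zero_le_power2[of "norm (T x)"] zero_le_power2[of "norm (P x)"]
    zero_le_power2[of "norm (x - T x)"]
  by (auto intro!: power2_le_imp_le[OF _ norm_ge_zero] simp del: zero_le_power2)

lemma T_selfadjoint: "inner (T x) y = inner x (T y)"
  using adj[OF N_T N'_P, of x y] adj[OF N_T N'_P, of y x]
  by (simp add: inner_diff_left inner_diff_right inner_commute)

text \<open>Split \<open>y\<close> into \<open>T y\<close> and \<open>y - T y = N (P' y)\<close> and
  move \<open>N\<close> across in each part.\<close>

lemma P_adjoint: "inner (P x) y = inner x (P' y)"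
  using adj[OF N_P' N'_P, of y x] adj[OF N_T N'_T, of x y]
  by (simp add: inner_diff_left inner_diff_right inner_commute)

lemma T_injective: "T x = 0 \<Longrightarrow> x = 0"
  using N_T[of x] N'_P[of x] lin(1) lin'(1) by auto

lemma bounded_linear_T: "bounded_linear T"
  using T_scaleC[of "complex_of_real _"]
  by (intro bounded_linear_intro[of _ 1]) (auto simp: T_add norm_T_le scaleC_of_real)

lemma bounded_linear_P: "bounded_linear P"
  using P_scaleC[of "complex_of_real _"]
  by (intro bounded_linear_intro[of _ 1]) (auto simp: P_add norm_P_le scaleC_of_real)

lemma bounded_linear_P': "bounded_linear P'"
  using P'_scaleC[of "complex_of_real _"]
  by (intro bounded_linear_intro[of _ 1]) (auto simp: P'_add norm_P' norm_P_le scaleC_of_real)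

text \<open>For \<open>N x = y\<close>, split \<open>x = T x + (x - T x)\<close>: under the
  hypothesis \<open>N'\<close> maps the parts to \<open>T y\<close> and \<open>y - T y\<close>. The
  converse inclusion is symmetric.\<close>

lemma eq_adj_op:
  assumes P: "\<And>x. P x = P' x"
  shows "N = N'"
proof -
  have "N' x = Some y" if "N x = Some y" for x y
  proof -
    have "N' (P x) = Some (P y)" using N'_T[of y] P P_eq[OF that] by simp
    then have "P y = x - T x" using N'_P[of x] by simp
    then have "N' (x - T x) = Some (y - T y)" using N'_P[of y] by simp
    moreover have "N' (T x) = Some (T y)" using N'_T[of x] P P_eq[OF that] by simp
    ultimately show ?thesis using lin'(2)[of "T x" "T y" "x - T x" "y - T y"] by simp
  qed
  moreover have "N x = Some y" if "N' x = Some y" for x y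
  proof -
    have "N (P' x) = Some (P' y)" using N_T[of y] P P'_eq[OF that] by simp
    then have "P' y = x - T x" using N_P'[of x] by simp
    then have "N (x - T x) = Some (y - T y)" using N_P'[of y] by simp
    moreover have "N (T x) = Some (T y)" using N_T[of x] P P'_eq[OF that] by simp
    ultimately show ?thesis using lin(2)[of "T x" "T y" "x - T x" "y - T y"] by simp
  qed
  ultimately show ?thesis by (metis ext not_Some_eq)
qed

end

section \<open>The product of a bounded and a positive operator\<close>

locale positive_times_bounded =
  fixes A B :: "'a::chilbert_space \<rightharpoonup> 'a"
  assumes B_bounded: "bounded_op B" and B_selfadjoint: "selfadjoint_op B"
    and A_selfadjoint: "selfadjoint_op A" and A_positive: "positive_op A"
    and normal_BA: "normal_op (B \<circ>\<^sub>m A)"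
begin

section \<open>Passage to inner product identities, and the adjoint of \<open>BA\<close>\<close>

sublocale normal_operator "B \<circ>\<^sub>m A" by standard (rule normal_BA)

definition b where "b x = the (B x)"

lemma B_eq: "B x = Some (b x)"
  using B_bounded by (auto simp: bounded_op_def b_def dom_def set_eq_iff)

lemma BA_eq: "(B \<circ>\<^sub>m A) x = Some y \<longleftrightarrow> (\<exists>u. A x = Some u \<and> y = b u)"
  by (auto simp: map_comp_def B_eq split: option.splits)

lemma AB_eq: "(A \<circ>\<^sub>m B) x = A (b x)"
  by (simp add: map_comp_def B_eq)

lemma densely_defined_A: "densely_defined A" and A_adj: "adj_op A = A"
  using A_selfadjoint by (auto simp: selfadjoint_op_def)

lemma linear_A: "linear_op A"
  using densely_defined_A by (simp add: densely_defined_def)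

lemmas linA = linear_opD[OF linear_A]

lemma densely_defined_B: "densely_defined B" and B_adj: "adj_op B = B"
  using B_selfadjoint by (auto simp: selfadjoint_op_def)

lemmas linB = linear_opD[OF densely_defined_B[unfolded densely_defined_def, THEN conjunct1]]

lemma b_symmetric: "inner (b x) y = inner x (b y)"
  using adj_op_eq_Some_iff_inner[OF densely_defined_B, of y "b y"] by (simp add: B_adj B_eq)

lemma b_scaleC: "b (c *\<^sub>C x) = c *\<^sub>C b x"
  using linB(3)[OF B_eq, of c x] by (simp add: B_eq)

lemma A_symmetric: "A x = Some u \<Longrightarrow> A y = Some v \<Longrightarrow> inner u y = inner x v"
  using adj_op_eq_Some_iff_inner[OF densely_defined_A, of y v] by (auto simp: A_adj)

lemma A_nonneg: "A x = Some u \<Longrightarrow> 0 \<le> inner u x"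
  using A_positive[unfolded positive_op_def, rule_format, of x]
  by (auto simp: Re_cinner[symmetric] complex_nonneg_Reals_iff)

text \<open>Moving \<open>b\<close> across turns the condition defining \<open>N' y\<close> into the
  one defining \<open>adj_op A (b y)\<close>, and \<open>A\<close> is its own adjoint.\<close>

lemma N'_eq: "N' = A \<circ>\<^sub>m B"
proof -
  have "N' y = Some z \<longleftrightarrow> A (b y) = Some z" for y z
  proof -
    have "N' y = Some z \<longleftrightarrow> (\<forall>x u. A x = Some u \<longrightarrow> inner (b u) y = inner x z)"
      unfolding adj_op_eq_Some_iff_inner[OF densely_defined] BA_eq by blast
    also have "\<dots> \<longleftrightarrow> adj_op A (b y) = Some z"
      unfolding adj_op_eq_Some_iff_inner[OF densely_defined_A] b_symmetric ..
    finally show ?thesis by (simp add: A_adj)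
  qed
  then show ?thesis by (intro ext) (metis AB_eq not_Some_eq)
qed

section \<open>The bounded operator \<open>AT\<close> and the form of \<open>A\<close>\<close>

definition S where "S x = the (A (T x))"

lemma A_T: "A (T x) = Some (S x)" and b_S: "b (S x) = P x"
  using N_T[of x] by (auto simp: BA_eq S_def)

lemma S_add: "S (x + y) = S x + S y"
  using linA(2)[OF A_T A_T, of x y] A_T[of "x + y"] by (simp add: T_add)

lemma S_scaleC: "S (c *\<^sub>C x) = c *\<^sub>C S x"
  using linA(3)[OF A_T, of c x] A_T[of "c *\<^sub>C x"] by (simp add: T_scaleC)

text \<open>The adjoint of the everywhere defined \<open>AT\<close> is given by \<open>TA\<close> on
  the dense domain of \<open>A\<close>.\<close>

lemma bounded_linear_S: "bounded_linear S"
proof -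
  obtain K where "\<And>u. norm (S u) \<le> K * norm u"
  proof (rule bounded_of_densely_defined_adjoint[of "dom A" S])
    show "closure (dom A) = UNIV" using densely_defined_A by (simp add: densely_defined_def)
    show "subspace (dom A)" using linA(1,2,4) by (auto simp: subspace_def dom_def)
    show "\<exists>w. \<forall>u. inner (S u) v = inner u w" if "v \<in> dom A" for v
    proof -
      from that obtain w where "A v = Some w" by blast
      then have "inner (S u) v = inner u (T w)" for u
        using A_symmetric[OF A_T] T_selfadjoint by simp
      then show ?thesis by blast
    qed
  qed blast
  then show ?thesis
    using S_scaleC[of "complex_of_real _"]
    by (intro bounded_linear_intro[of _ K]) (auto simp: S_add scaleC_of_real mult.commute)
qed

lemma A_Cauchy_Schwarz:
  assumes x: "A x = Some u" and y: "A y = Some v"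
  shows "(inner u y)\<^sup>2 \<le> inner u x * inner v y"
proof -
  have *: "0 \<le> inner u x - 2 * t * inner u y + t\<^sup>2 * inner v y" for t
  proof -
    have "A (x - t *\<^sub>R y) = Some (u - t *\<^sub>R v)" by (intro linA x y)
    note A_nonneg[OF this]
    then show ?thesis
      using A_symmetric[OF x y]
      by (simp add: inner_diff_left inner_diff_right inner_commute power2_eq_square algebra_simps)
  qed
  have vy: "0 \<le> inner v y" by (rule A_nonneg[OF y])
  show ?thesis
  proof (cases "inner v y = 0")
    case True
    \<comment> \<open>For nonzero \<open>inner u y\<close> the chosen \<open>t\<close> would make
      the quadratic equal to -1.\<close>
    then have "inner u y = 0"
      using *[of "(inner u x + 1) / (2 * inner u y)"] by (cases "inner u y = 0") auto
    then show ?thesis using True by simp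
  next
    case False
    then have "0 \<le> inner u x - (inner u y)\<^sup>2 / inner v y"
      using *[of "inner u y / inner v y"] by (simp add: power2_eq_square)
    then show ?thesis using vy False by (simp add: field_simps)
  qed
qed

section \<open>Verification of the symmetrizer conditions\<close>

definition R where "R x = - (\<i> *\<^sub>C P x)"

definition R' where "R' x = \<i> *\<^sub>C P' x"

lemma bounded_linear_ii: "bounded_linear (\<lambda>x::'a. \<i> *\<^sub>C x)"
  by (intro bounded_linear_intro[of _ 1])
    (auto simp: scaleC_add_right scaleC_scaleR_commute norm_ii)

text \<open>With \<open>z = T (T x)\<close> the right side is the form at \<open>(N - il) z\<close>.
  Its cross term vanishes, leaving \<open>l^2\<close> times the form at \<open>z\<close> plus the
  nonnegative form at \<open>N z\<close>.\<close>

lemma form_shift: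
  "l\<^sup>2 * inner (S (T x)) (T (T x)) \<le> inner (S (R x - l *\<^sub>R T x)) (T (R x - l *\<^sub>R T x))"
proof -
  interpret T: bounded_linear T by (rule bounded_linear_T)
  interpret S: bounded_linear S by (rule bounded_linear_S)
  define y where "y = T (P x)"
  have Tm: "T (R x - l *\<^sub>R T x) = - (\<i> *\<^sub>C y) - l *\<^sub>R T (T x)"
    by (simp add: R_def y_def T.diff T.neg T.scaleR T_scaleC)
  have Sm: "S (R x - l *\<^sub>R T x) = - (\<i> *\<^sub>C S (P x)) - l *\<^sub>R S (T x)"
    by (simp add: R_def S.diff S.neg S.scaleR S_scaleC)
  have bS: "b (S (T x)) = y" by (simp add: b_S y_def T_P)
  have Ay: "A y = Some (S (P x))" by (simp add: y_def A_T)
  \<comment> \<open>As \<open>y = b (S (T x))\<close> with \<open>B\<close> self-adjoint,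
    \<open>cinner y (S (T x))\<close> is real, so its product with \<open>\<i>\<close> has real part
    0.\<close>
  have cross: "inner (\<i> *\<^sub>C y) (S (T x)) = 0"
  proof -
    have "inner (\<i> *\<^sub>C y) (S (T x)) = inner (S (T x)) (\<i> *\<^sub>C y)"
      unfolding bS[symmetric] b_scaleC[symmetric] by (simp add: b_symmetric b_scaleC inner_commute)
    then show ?thesis
      by (metis bS b_scaleC b_symmetric inner_commute inner_ii_left equal_neg_zero)
  qed
  have "inner (\<i> *\<^sub>C S (P x)) (T (T x)) = inner (\<i> *\<^sub>C y) (S (T x))"
    using A_symmetric[OF linA(3)[OF Ay] A_T] by simp
  then have "inner (S (R x - l *\<^sub>R T x)) (T (R x - l *\<^sub>R T x))
      = inner (S (P x)) y + l\<^sup>2 * inner (S (T x)) (T (T x))"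
    unfolding Tm Sm using cross
    by (simp add: inner_diff_left inner_diff_right inner_commute inner_ii_left ii_ii
        power2_eq_square)
  then show ?thesis using A_nonneg[OF Ay] by simp
qed

lemma form_dominates:
  assumes K: "\<And>x. norm (b x) \<le> K * norm x" "0 \<le> K"
  shows "norm (R x) ^ 4 \<le> K * inner (S x) (T x) * (norm x)\<^sup>2"
proof -
  \<comment> \<open>Since \<open>N' = AB\<close>, membership of \<open>P x\<close> in the domain of
    \<open>N'\<close> puts \<open>b (P x)\<close> into that of \<open>A\<close>.\<close>
  have A: "A (b (P x)) = Some (x - T x)"
    using N'_P[of x] unfolding N'_eq AB_eq .
  have "norm (R x) ^ 4 = (inner (P x) (P x))\<^sup>2"
    by (simp add: R_def norm_ii dot_square_norm power_mult[symmetric])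
  also have "inner (P x) (P x) = inner (S x) (b (P x))"
    by (metis b_S b_symmetric)
  also have "(inner (S x) (b (P x)))\<^sup>2 \<le> inner (S x) (T x) * inner (x - T x) (b (P x))"
    by (rule A_Cauchy_Schwarz[OF A_T A])
  also have "\<dots> \<le> inner (S x) (T x) * (norm x * (K * norm x))"
  proof (intro mult_left_mono A_nonneg[OF A_T])
    have "norm (b (P x)) \<le> K * norm x"
      using K(1)[of "P x"] mult_left_mono[OF norm_P_le[of x] K(2)] by linarith
    then show "inner (x - T x) (b (P x)) \<le> norm x * (K * norm x)"
      using norm_diff_T_le[of x]
      by (intro order_trans[OF norm_cauchy_schwarz] mult_mono) auto
  qed
  finally show ?thesis by (simp add: power2_eq_square mult_ac)
qed

lemma P_eq_P': "P x = P' x"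
proof -
  obtain K0 where K0: "\<And>x. norm (b x) \<le> K0 * norm x"
    using B_bounded by (auto simp: bounded_op_def b_def)
  \<comment> \<open>The constant in \<open>bounded_op\<close> comes without a sign.\<close>
  define K where "K = max 0 K0"
  have K: "norm (b x) \<le> K * norm x" "0 \<le> K" for x
    using K0[of x] mult_right_mono[of K0 K "norm x"] by (auto simp: K_def)
  interpret commuting_symmetrizer T R R' S K
  proof (rule commuting_symmetrizer.intro)
    show "bounded_linear T" "bounded_linear S" by (fact bounded_linear_T bounded_linear_S)+
    show "bounded_linear R" "bounded_linear R'"
      unfolding R_def R'_def
      by (intro bounded_linear_minus bounded_linear_compose[OF bounded_linear_ii]
          bounded_linear_P bounded_linear_P')+
    show "inner (R x) y = inner x (R' y)" for x y
      by (simp add: R_def R'_def inner_ii_left P_adjoint[symmetric] P'_scaleC[symmetric])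
    show "T (R x) = R (T x)" "T (R' x) = R' (T x)" for x
      using T_scaleC[of "- \<i>" "P x"]
      by (simp_all add: R_def R'_def T_scaleC T_P T_P' scaleC_minus_left)
    show "R (R' x) = R' (R x)" for x
      using P'_scaleC[of "- \<i>" "P x"]
      by (simp add: R_def R'_def P_scaleC P_P' scaleC_minus_left scaleC_minus_right)
    show "inner (S x) (T y) = inner (S y) (T x)" for x y
      using A_symmetric[OF A_T A_T] by (metis inner_commute)
  qed (fact T_selfadjoint norm_T_le T_injective form_shift form_dominates[OF K] K(2))+
  have "\<i> *\<^sub>C P x = \<i> *\<^sub>C P' x" using real_part_eq_0[of x] by (simp add: R_def R'_def)
  then show ?thesis by (metis ii_ii neg_equal_iff_equal)
qed

end

theorem theorem2p1:
  fixes A B :: "'a::chilbert_space \<rightharpoonup> 'a"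
  assumes "bounded_op B" and "selfadjoint_op B"
    and "selfadjoint_op A" and "positive_op A"
    and "normal_op (B \<circ>\<^sub>m A)"
  shows "selfadjoint_op (B \<circ>\<^sub>m A) \<and> selfadjoint_op (A \<circ>\<^sub>m B) \<and> A \<circ>\<^sub>m B = B \<circ>\<^sub>m A"
proof -
  interpret positive_times_bounded A B using assms by unfold_locales
  have "B \<circ>\<^sub>m A = adj_op (B \<circ>\<^sub>m A)" by (rule eq_adj_op[OF P_eq_P'])
  moreover from this have "A \<circ>\<^sub>m B = B \<circ>\<^sub>m A" using N'_eq by simp
  ultimately show ?thesis using densely_defined by (simp add: selfadjoint_op_def)
qed

end
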